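(* Let $F$ be a field with $\operatorname{Char}(F)\neq 2$ and let $R$ be a simple associative unital $F$-algebra. Let $*$ be an involution on $R$ of the first kind with set of symmetric elements $S$ and set of skew-symmetric elements $K$, and assume $S\subsetneq R$. Assume that there exist $x\in S$ and $y\in K$ such that $xy-yx\neq 0$. Then $S^2K=R$.
   Context: $S=\{r\in R: r^*=r\}$ and $K=\{r\in R: r^*=-r\}$. The involution $*$ is of the first kind if $Z(R)\subseteq S$, where $Z(R)$ is the center of $R$. $S^2K$ denotes the $F$-subspace of $R$ generated by all products $abk$ with $a,b\in S$, $k\in K$. *)

theory Defs
  imports Complex_Main
begin

text \<open>Associative unital algebras over an arbitrary field, with the type \<open>'r\<close> as underlying
  ring. The class \<open>ring_1\<close> includes \<open>0 \<noteq> 1\<close>, so the algebra is nonzero.\<close>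

locale unital_algebra = vector_space scale
  for scale :: "'f::field \<Rightarrow> 'r::ring_1 \<Rightarrow> 'r" +
  assumes scale_mult_left: "scale c x * y = scale c (x * y)"
    and scale_mult_right: "x * scale c y = scale c (x * y)"

definition two_sided_ideal :: "'r::ring_1 set \<Rightarrow> bool"
  where "two_sided_ideal I \<longleftrightarrow>
    0 \<in> I \<and> (\<forall>x\<in>I. \<forall>y\<in>I. x + y \<in> I) \<and> (\<forall>x\<in>I. \<forall>r. r * x \<in> I \<and> x * r \<in> I)"

text \<open>Since \<open>scale c x = scale c 1 * x\<close> in a unital algebra, every two-sided ring ideal is a
  subspace, so there is no difference between simplicity as a ring and as an algebra.\<close>

locale simple_unital_algebra = unital_algebra scale
  for scale :: "'f::field \<Rightarrow> 'r::ring_1 \<Rightarrow> 'r" +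
  assumes simple: "two_sided_ideal (I :: 'r set) \<Longrightarrow> I = {0} \<or> I = UNIV"

definition ring_center :: "'r::ring_1 set"
  where "ring_center = {z. \<forall>r. z * r = r * z}"

definition involution :: "('r::ring_1 \<Rightarrow> 'r) \<Rightarrow> bool"
  where "involution star \<longleftrightarrow>
    (\<forall>x y. star (x + y) = star x + star y) \<and>
    (\<forall>x y. star (x * y) = star y * star x) \<and>
    (\<forall>x. star (star x) = x)"

definition symmetric_elements :: "('r::ring_1 \<Rightarrow> 'r) \<Rightarrow> 'r set"
  where "symmetric_elements star = {r. star r = r}"

definition skew_elements :: "('r::ring_1 \<Rightarrow> 'r) \<Rightarrow> 'r set"
  where "skew_elements star = {r. star r = - r}"

text \<open>Linearity over the field is not required of an involution. An involution of the first kind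
  fixes the central elements \<open>scale c 1\<close>, hence it is linear automatically.\<close>

definition first_kind :: "('r::ring_1 \<Rightarrow> 'r) \<Rightarrow> bool"
  where "first_kind star \<longleftrightarrow> ring_center \<subseteq> symmetric_elements star"

definition (in unital_algebra) S2K :: "('r \<Rightarrow> 'r) \<Rightarrow> 'r set"
  where "S2K star = span {a * b * k | a b k.
    a \<in> symmetric_elements star \<and> b \<in> symmetric_elements star \<and> k \<in> skew_elements star}"

end

theory Submission
  imports Defs
begin

text \<open>
  Write \<open>S\<close>, \<open>K\<close> for the symmetric and the skew elements, \<open>V = S\<^sup>2K\<close>, and \<open>L\<close> for the additive
  span of the commutators \<open>[s, t]\<close> with \<open>s, t \<in> S\<close>. As \<open>2\<close> is invertible, \<open>R = S + K\<close>, and the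
  involution gives \<open>[S, S] \<subseteq> K\<close>, \<open>[S, K] \<subseteq> S\<close> and \<open>sk + ks \<in> K\<close>.

  A simple ring is generated as an ideal by any nonzero element \<open>l\<close>, so it is enough to find
  \<open>l \<noteq> 0\<close> with \<open>R l R \<subseteq> V\<close>. Moving \<open>k\<close> past symmetric elements by means of \<open>sk + ks \<in> K\<close> shows
  that \<open>V\<close> contains not only \<open>SSK\<close> but also \<open>SKS\<close> and \<open>KSS\<close>, and, as \<open>1 \<in> S\<close>, also \<open>SK\<close>, \<open>KS\<close> and
  \<open>K\<close>. Now an element \<open>l \<in> L\<close> is of two kinds at once: it is skew, whence \<open>S l \<subseteq> SK \<subseteq> V\<close>, and it is
  a sum of products of two symmetric elements, whence \<open>K l \<subseteq> KSS \<subseteq> V\<close>. Thus \<open>R L \<subseteq> V\<close>. Since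
  \<open>[L, K] \<subseteq> L\<close> and \<open>[L, S] \<subseteq> S\<close>, this extends to \<open>R L R \<subseteq> V\<close> (lemma \<open>ideal_of_commutator_in_S2K\<close>).

  It remains to exclude \<open>L = 0\<close>, that is, that \<open>S\<close> is commutative. In that case, for \<open>x \<in> S\<close>, the
  inner derivation \<open>d = [x, _]\<close> vanishes on \<open>S\<close> and maps \<open>K\<close> into \<open>S\<close>, so \<open>d\<^sup>2 = 0\<close>. A nonzero inner
  derivation of a simple ring without \<open>2\<close>-torsion cannot have square zero, so \<open>x\<close> is central, which
  contradicts \<open>[x, y] \<noteq> 0\<close>.
\<close>

section \<open>Simple algebras of characteristic not two\<close>

lemma two_neq_0_if_CHAR_neq_2:
  assumes "CHAR('f::field) \<noteq> 2"
  shows "(2::'f) \<noteq> 0"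
proof
  assume "(2::'f) = 0"
  then have "CHAR('f) dvd 2"
    using of_nat_eq_0_iff_char_dvd[of 2, where 'a = 'f] by simp
  then have "CHAR('f) \<le> 2" "CHAR('f) \<noteq> 0"
    by (auto intro: dvd_imp_le dest: dvd_pos_nat[rotated])
  then have "CHAR('f) = 1"
    using assms by linarith
  then show False
    using CHAR_not_1 by simp
qed

context simple_unital_algebra
begin

text \<open>The elements \<open>x\<close> with \<open>R x R \<subseteq> V\<close> form a two-sided ideal, the largest one inside \<open>V\<close>. This form of
  simplicity avoids sums of products \<open>r l t\<close>.\<close>

lemma additive_set_containing_ideal_eq_UNIV:
  fixes V :: "'r set"
  assumes zero: "0 \<in> V" and add: "\<And>u v. u \<in> V \<Longrightarrow> v \<in> V \<Longrightarrow> u + v \<in> V"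
    and l: "l \<noteq> 0" "\<And>r t. r * l * t \<in> V"
  shows "V = UNIV"
proof -
  define I where "I = {x. \<forall>r t. r * x * t \<in> V}"
  have "r * (u * x) * t \<in> V" "r * (x * u) * t \<in> V" if "x \<in> I" for r u x t
  proof -
    have "(r * u) * x * t \<in> V" "r * x * (u * t) \<in> V"
      using that by (auto simp: I_def)
    then show "r * (u * x) * t \<in> V" "r * (x * u) * t \<in> V"
      by (simp_all add: mult.assoc)
  qed
  then have "two_sided_ideal I"
    unfolding two_sided_ideal_def
    by (auto simp: I_def zero distrib_left distrib_right intro: add)
  moreover have "l \<in> I"
    using l by (simp add: I_def)
  ultimately have "I = UNIV"
    using simple l(1) by blast
  then have "1 * v * 1 \<in> V" for v
    unfolding I_def by blast
  then show ?thesis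
    by auto
qed

text \<open>Otherwise the right annihilator of \<open>a\<close> would contain the ideal generated by \<open>a\<close>, hence \<open>1\<close>.\<close>

lemma eq_0_if_sandwich_eq_0:
  fixes a :: 'r
  assumes "\<And>w. a * w * a = 0"
  shows "a = 0"
proof (rule ccontr)
  assume "a \<noteq> 0"
  moreover have "a * (r * a * t) = 0" for r t
    using assms[of r] by (metis mult.assoc mult_zero_left)
  ultimately have "{v. a * v = 0} = UNIV"
    by (intro additive_set_containing_ideal_eq_UNIV[of _ a]) (auto simp: distrib_left)
  then have "a * 1 = 0"
    by blast
  with \<open>a \<noteq> 0\<close> show False
    by simp
qed

text \<open>Let \<open>d = [x, _]\<close>. From \<open>d\<^sup>2 = 0\<close> and the Leibniz rule, \<open>0 = d\<^sup>2(r t) = 2 d(r) d(t)\<close>; replacing \<open>t\<close>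
  by \<open>w t\<close> gives \<open>d(r) w d(t) = 0\<close> for all \<open>w\<close>.\<close>

lemma central_if_square_zero_inner_derivation:
  fixes x y :: 'r
  assumes two: "(2::'f) \<noteq> 0"
    and sq: "\<And>r. x * (x * r - r * x) - (x * r - r * x) * x = 0"
  shows "x * y = y * x"
proof -
  define d where "d r = x * r - r * x" for r
  have leibniz: "d (r * t) = d r * t + r * d t" for r t
    by (simp add: d_def algebra_simps)
  have d_add: "d (r + t) = d r + d t" for r t
    by (simp add: d_def algebra_simps)
  have dd: "d (d r) = 0" for r
    using sq by (simp add: d_def)
  have prod0: "d r * d t = 0" for r t
  proof -
    have "d (d (r * t)) = d r * d t + d r * d t"
      by (simp add: leibniz d_add dd)
    then have "d r * d t + d r * d t = 0"
      by (simp add: dd)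
    then have "scale 2 (d r * d t) = 0"
      by (metis one_add_one scale_left_distrib scale_one)
    then show ?thesis
      using two by simp
  qed
  have "d y * w * d y = 0" for w
    using prod0[of y "w * y"] prod0[of y w]
    by (simp add: leibniz distrib_left flip: mult.assoc)
  then have "d y = 0"
    by (rule eq_0_if_sandwich_eq_0)
  then show ?thesis
    by (simp add: d_def)
qed

end

section \<open>Symmetric and skew elements\<close>

locale algebra_with_involution = unital_algebra scale
  for scale :: "'f::field \<Rightarrow> 'r::ring_1 \<Rightarrow> 'r" +
  fixes star :: "'r \<Rightarrow> 'r"
  assumes involution: "involution star"
    and two_neq_0: "(2::'f) \<noteq> 0"
begin

abbreviation "S \<equiv> symmetric_elements star"
abbreviation "K \<equiv> skew_elements star"
abbreviation "V \<equiv> S2K star"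

lemma star_add: "star (x + y) = star x + star y"
  and star_mult: "star (x * y) = star y * star x"
  and star_star: "star (star x) = x"
  using involution by (auto simp: involution_def)

lemma star_zero: "star 0 = 0"
  using star_add[of 0 0] by simp

lemma star_minus: "star (- x) = - star x"
  using star_add[of x "- x"] by (simp add: star_zero eq_neg_iff_add_eq_0 add.commute)

lemma star_diff: "star (x - y) = star x - star y"
  using star_add[of x "- y"] by (simp add: star_minus)

lemma star_one: "star 1 = 1"
  by (metis mult.left_neutral star_mult star_star)

lemmas mem_simps = symmetric_elements_def skew_elements_def star_add star_mult star_minus
  star_diff star_one

lemma one_sym: "1 \<in> S"
  by (simp add: mem_simps)

lemma commutator_sym_sym: "s \<in> S \<Longrightarrow> t \<in> S \<Longrightarrow> s * t - t * s \<in> K"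
  by (simp add: mem_simps)

lemma commutator_sym_skew: "s \<in> S \<Longrightarrow> k \<in> K \<Longrightarrow> s * k - k * s \<in> S"
  by (simp add: mem_simps)

lemma commutator_skew_sym: "k \<in> K \<Longrightarrow> s \<in> S \<Longrightarrow> k * s - s * k \<in> S"
  by (simp add: mem_simps)

lemma anticommutator_skew_sym: "k \<in> K \<Longrightarrow> s \<in> S \<Longrightarrow> k * s + s * k \<in> K"
  by (simp add: mem_simps)

lemma halve_add: "scale (1/2) x + scale (1/2) x = x"
proof -
  have "scale (1/2) x + scale (1/2) x = scale (1/2 + 1/2) x"
    by (simp only: scale_left_distrib)
  also have "(1/2 + 1/2 :: 'f) = 1"
    using two_neq_0 by (simp add: field_simps)
  finally show ?thesis
    by simp
qed

text \<open>An element \<open>x\<close> is determined by \<open>x + x\<close>, so an additive map commutes with halving.\<close>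

lemma star_halve: "star (scale (1/2) x) = scale (1/2) (star x)"
proof -
  have "star (scale (1/2) x) = scale (1/2) (star (scale (1/2) x) + star (scale (1/2) x))"
    by (simp only: scale_right_distrib halve_add)
  also have "\<dots> = scale (1/2) (star x)"
    by (simp only: halve_add flip: star_add)
  finally show ?thesis .
qed

lemma sym_skew_decomposition:
  obtains s k where "s \<in> S" "k \<in> K" "r = s + k"
proof
  show "scale (1/2) (r + star r) \<in> S"
    by (simp add: symmetric_elements_def star_halve star_add star_star add.commute)
  show "scale (1/2) (r - star r) \<in> K"
    by (simp add: skew_elements_def star_halve star_diff star_star flip: scale_minus_right)
  show "r = scale (1/2) (r + star r) + scale (1/2) (r - star r)"
    by (simp add: halve_add flip: scale_right_distrib)
       (simp add: scale_right_distrib halve_add)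
qed

section \<open>Products contained in \<open>S\<^sup>2K\<close>\<close>

lemma V_add: "u \<in> V \<Longrightarrow> v \<in> V \<Longrightarrow> u + v \<in> V"
  and V_diff: "u \<in> V \<Longrightarrow> v \<in> V \<Longrightarrow> u - v \<in> V"
  and V_zero: "0 \<in> V"
  unfolding S2K_def by (auto intro: span_add span_diff span_zero)

lemma SSK_in_V: "a \<in> S \<Longrightarrow> b \<in> S \<Longrightarrow> k \<in> K \<Longrightarrow> a * b * k \<in> V"
  unfolding S2K_def by (rule span_base) auto

lemma SK_in_V: "a \<in> S \<Longrightarrow> k \<in> K \<Longrightarrow> a * k \<in> V"
  using SSK_in_V[of a 1 k] one_sym by simp

lemma SKS_in_V:
  assumes "a \<in> S" "k \<in> K" "b \<in> S"
  shows "a * k * b \<in> V"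
proof -
  have "a * k * b = a * (k * b + b * k) - a * b * k"
    by (simp add: algebra_simps)
  then show ?thesis
    using V_diff SK_in_V SSK_in_V anticommutator_skew_sym assms by metis
qed

lemma KS_in_V: "k \<in> K \<Longrightarrow> b \<in> S \<Longrightarrow> k * b \<in> V"
  using SKS_in_V[of 1 k b] one_sym by simp

lemma KSS_in_V:
  assumes "k \<in> K" "a \<in> S" "b \<in> S"
  shows "k * a * b \<in> V"
proof -
  have "k * a * b = (k * a + a * k) * b - a * k * b"
    by (simp add: algebra_simps)
  then show ?thesis
    using V_diff KS_in_V SKS_in_V anticommutator_skew_sym assms by metis
qed

text \<open>The point where \<open>[s, t]\<close> is used both as a skew element, after a symmetric factor, and as a
  difference of products of symmetric elements, after a skew factor.\<close>

lemma left_ideal_of_commutator_in_S2K: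
  assumes "s \<in> S" "t \<in> S"
  shows "r * (s * t - t * s) \<in> V"
proof -
  obtain a k where r: "a \<in> S" "k \<in> K" "r = a + k"
    by (rule sym_skew_decomposition)
  have "r * (s * t - t * s) = a * (s * t - t * s) + (k * s * t - k * t * s)"
    by (simp add: r(3) algebra_simps)
  then show ?thesis
    using r assms by (simp only: V_add V_diff SK_in_V KSS_in_V commutator_sym_sym)
qed

text \<open>A right factor is moved to the left of \<open>l = [s, t]\<close>. For a skew factor \<open>k\<close> the error \<open>[l, k]\<close> is,
  by the Jacobi identity, again a sum of commutators of symmetric elements. For a symmetric factor
  \<open>b\<close> the error \<open>[l, b]\<close> is only symmetric; this suffices after a skew left factor, while a symmetric
  left factor gives a product in \<open>SKS\<close>.\<close>

lemma ideal_of_commutator_in_S2K: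
  assumes st: "s \<in> S" "t \<in> S"
  shows "r * (s * t - t * s) * u \<in> V"
proof -
  define l where "l = s * t - t * s"
  have l: "l \<in> K"
    using st by (simp add: l_def commutator_sym_sym)
  obtain a j where r: "a \<in> S" "j \<in> K" "r = a + j"
    by (rule sym_skew_decomposition)
  obtain b k where u: "b \<in> S" "k \<in> K" "u = b + k"
    by (rule sym_skew_decomposition)
  have Rl: "v * l \<in> V" for v
    unfolding l_def using st by (rule left_ideal_of_commutator_in_S2K)
  let ?s = "s * k - k * s" and ?t = "t * k - k * t"
  have "r * l * k = r * (?s * t - t * ?s) + r * (s * ?t - ?t * s) + r * k * l"
    by (simp add: l_def algebra_simps)
  moreover have "r * (?s * t - t * ?s) \<in> V" "r * (s * ?t - ?t * s) \<in> V"
    using st u by (simp_all only: left_ideal_of_commutator_in_S2K commutator_sym_skew)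
  ultimately have K: "r * l * k \<in> V"
    using Rl V_add by presburger
  have "r * l * b = a * l * b + (j * (l * b - b * l) + j * b * l)"
    by (simp add: r(3) algebra_simps)
  moreover have "a * l * b \<in> V" "j * (l * b - b * l) \<in> V"
    using r u l by (simp_all only: SKS_in_V KS_in_V commutator_skew_sym)
  ultimately have S: "r * l * b \<in> V"
    using Rl V_add by presburger
  have "r * l * u = r * l * b + r * l * k"
    by (simp add: u(3) algebra_simps)
  then show ?thesis
    using K S V_add by (simp add: l_def)
qed

text \<open>If \<open>S\<close> is commutative, then \<open>[x, S] = 0\<close> and \<open>[x, [x, K]] \<subseteq> [x, S] = 0\<close>.\<close>

lemma square_zero_if_sym_commute:
  assumes comm: "\<And>s t. s \<in> S \<Longrightarrow> t \<in> S \<Longrightarrow> s * t = t * s" and x: "x \<in> S"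
  shows "x * (x * r - r * x) - (x * r - r * x) * x = 0"
proof -
  obtain s k where r: "s \<in> S" "k \<in> K" "r = s + k"
    by (rule sym_skew_decomposition)
  have "x * r - r * x = x * k - k * x"
    using comm[OF x r(1)] by (simp add: r(3) distrib_left distrib_right)
  then show ?thesis
    using comm[OF x commutator_sym_skew[OF x r(2)]] by simp
qed

end

section \<open>The span \<open>S\<^sup>2K\<close> in a simple algebra\<close>

theorem corollary3p26:
  fixes scale :: "'f::field \<Rightarrow> 'r::ring_1 \<Rightarrow> 'r"
    and star :: "'r \<Rightarrow> 'r"
  assumes "CHAR('f) \<noteq> 2"
    and "simple_unital_algebra scale"
    and "involution star"
    and "first_kind star"
    and "symmetric_elements star \<subset> UNIV"
    and "\<exists>x\<in>symmetric_elements star. \<exists>y\<in>skew_elements star. x * y - y * x \<noteq> 0"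
  shows "unital_algebra.S2K scale star = UNIV"
proof -
  interpret simple_unital_algebra scale
    by fact
  have two: "(2::'f) \<noteq> 0"
    using assms(1) by (rule two_neq_0_if_CHAR_neq_2)
  interpret algebra_with_involution scale star
    by unfold_locales (use assms(3) two in auto)
  obtain x y where x: "x \<in> S" and xy: "x * y - y * x \<noteq> 0"
    using assms(6) by blast
  have "\<exists>s\<in>S. \<exists>t\<in>S. s * t - t * s \<noteq> 0"
  proof (rule ccontr)
    assume "\<not> ?thesis"
    then have "s * t = t * s" if "s \<in> S" "t \<in> S" for s t
      using that by auto
    then have "x * y = y * x"
      using central_if_square_zero_inner_derivation[OF two] square_zero_if_sym_commute x by blast
    with xy show False
      by simp
  qed
  then obtain s t where st: "s \<in> S" "t \<in> S" "s * t - t * s \<noteq> 0"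
    by blast
  show ?thesis
    using V_zero V_add st(3) ideal_of_commutator_in_S2K[OF st(1,2)]
    by (rule additive_set_containing_ideal_eq_UNIV)
qed

end
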